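(* Let $k\ge1$ and let $f:D\to\Lambda\times\mathbb{R}^u\times\mathbb{R}^s$ be a $C^{k+1}$ map satisfying the covering conditions, the rate conditions of order $k$ and the backward cone conditions (so that $W^{cs}=\{(\lambda,w^{cs}(\lambda,y),y):\lambda\in\Lambda,y\in\overline B_s(R)\}$ for a function $w^{cs}:\Lambda\times\overline B_s(R)\to\overline B_u(R)$). Let $M\in(0,L)$ and $\xi=\inf_{z\in D}m[\partial f_x/\partial x(P(z))]-\frac1M\sup_{z\in D}\|\partial f_x/\partial(\lambda,y)(z)\|$, $\mu=\sup_{z\in D}\{\|\partial f_{(\lambda,y)}/\partial(\lambda,y)(z)\|+M\|\partial f_{(\lambda,y)}/\partial x(z)\|\}$. If $\xi/\mu>1$, then $w^{cs}$ is Lipschitz with constant $M$.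
   Context: $c,u,s$ positive integers, $\Lambda=(\mathbb{R}/\mathbb{Z})^c$, $R_\Lambda=\tfrac12$; points are "in the same chart" if their $\lambda$-components have lifts to $\mathbb{R}^c$ at distance $\le R_\Lambda$; differences, norms, cones, derivatives and Lipschitz constants are computed in such lifts; $\overline B_c(\lambda,R_\Lambda)$ closed ball about a lift of $\lambda$. $B_n(R),\overline B_n(R)$ open/closed balls at $0$; Euclidean norms. $0<R<R_\Lambda/2$, $D=\Lambda\times\overline B_u(R)\times\overline B_s(R)$, $z=(\lambda,x,y)$, projections $\pi_\lambda,\pi_x,\pi_y,\pi_{(\lambda,x)},\pi_{(\lambda,y)}$, $f=(f_\lambda,f_x,f_y)$. $m(A)=\max\{c:\|Av\|\ge c\|v\|\}$, $m(\mathbf A)=\inf_{A\in\mathbf A}m(A)$; $[\partial g/\partial w(U)]$ = matrices with $(i,j)$ entry in $[\inf_U\partial g_i/\partial w_j,\sup_U\partial g_i/\partial w_j]$; $P(z)=\{w\in D:\|\pi_\lambda w-\pi_\lambda z\|\le R_\Lambda/2\}$. Fix $L\in(2R/R_\Lambda,1)$; constants $\mu_{s,1}=\sup_{D}\{\|\partial_y f_y\|+\frac1L\|\partial_{(\lambda,x)}f_y\|\}$, $\mu_{s,2}=\sup_D\{\|\partial_yf_y\|+L\|\partial_yf_{(\lambda,x)}\|\}$, $\xi_{u,1}=\inf_D\{m(\partial_xf_x)-\frac1L\|\partial_{(\lambda,y)}f_x\|\}$, $\xi_{u,1,P}=\inf_{z\in D}m[\partial_xf_x(P(z))]-\frac1L\sup_D\|\partial_{(\lambda,y)}f_x\|$,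 $\xi_{u,2}=\inf_D\{m(\partial_xf_x)-L\|\partial_xf_{(\lambda,y)}\|\}$, $\mu_{cs,1}=\sup_D\{\|\partial_{(\lambda,y)}f_{(\lambda,y)}\|+L\|\partial_xf_{(\lambda,y)}\|\}$, $\mu_{cs,2}=\sup_D\{\|\partial_{(\lambda,y)}f_{(\lambda,y)}\|+\frac1L\|\partial_{(\lambda,y)}f_x\|\}$, $\xi_{cu,1}=\inf_D\{m(\partial_{(\lambda,x)}f_{(\lambda,x)})-L\|\partial_yf_{(\lambda,x)}\|\}$, $\xi_{cu,1,P}=\inf_{z\in D}m[\partial_{(\lambda,x)}f_{(\lambda,x)}(P(z))]-L\sup_D\|\partial_yf_{(\lambda,x)}\|$, $\xi_{cu,2}=\inf_D\{m(\partial_{(\lambda,x)}f_{(\lambda,x)})-\frac1L\|\partial_{(\lambda,x)}f_y\|\}$. Rate conditions of order $k$: all $\xi$'s positive; $\mu_{s,1}<1<\xi_{u,1,P}$; $\mu_{cs,1}<\xi_{u,1,P}$; $\mu_{s,1}<\xi_{cu,1,P}$; for $1\le j\le k$: $\mu_{cs,1}^{j+1}<\xi_{u,2}$, $\mu_{s,2}<\xi_{cu,1}^{j+1}$; $\mu_{cs,2}<\xi_{u,1}$; $\mu_{s,1}<\xi_{cu,2}$. Cones $J_s(z,M)=\{\|(\lambda,x)-\pi_{(\lambda,x)}z\|\le M\|y-\pi_yz\|\}$, $J_u(z,M)=\{\|(\lambda,y)-\pi_{(\lambda,y)}z\|\le M\|x-\pi_xz\|\}$. $W^{cs}=\{z:f^n(z)\in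 D$ for all $n\ge0\}$. Backward cone conditions: if $z_1,z_2,f(z_1),f(z_2)\in D$ and $f(z_1)\in J_s(f(z_2),1/L)$ then $z_1\in J_s(z_2,1/L)$. Covering conditions: with $D_\lambda=\overline B_c(\lambda,R_\Lambda)\times\overline B_u(R)\times\overline B_s(R)$, $D^+_\lambda=\overline B_c(\lambda,R_\Lambda)\times\overline B_u(R)\times\partial B_s(R)$, $D^-_\lambda=\overline B_c(\lambda,R_\Lambda)\times\partial B_u(R)\times B_s(R)$: for each $z\in D$ there exist $\lambda^*$, a homotopy $h:[0,1]\times U\to B_c(\lambda^*,R_\Lambda)\times\mathbb{R}^u\times\mathbb{R}^s$ ($U=J_u(z,1/L)\cap D$) and linear $A$ with $h_0=f|_U$, $h_\alpha(U\cap D^-_{\pi_\lambda z})\cap D_{\lambda^*}=\emptyset$, $h_\alpha(U)\cap D^+_{\lambda^*}=\emptyset$ for all $\alpha$, $h_1(\lambda,x,y)=(\lambda^*,Ax,0)$, $A(\partial B_u(R))\subset\mathbb{R}^u\setminus\overline B_u(R)$. *)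

theory Defs
  imports "HOL-Analysis.Analysis"
begin

text \<open>Phase space in lifts: points z = (lambda, x, y) with lambda a lift in R^c of a point
  of the torus (R/Z)^c, x in R^u, y in R^s.  A map f : D -> Lambda x R^u x R^s is represented
  by a lift F on R^c x R^u x R^s (compatible with integer translations in lambda).
  R_Lambda = 1/2.\<close>

type_synonym ('c,'u,'s) pt = "(real^'c) \<times> (real^'u) \<times> (real^'s)"

definition intvec :: "real^'c \<Rightarrow> bool" where
  "intvec k \<longleftrightarrow> (\<forall>i. k $ i \<in> \<int>)"

definition RL :: real where "RL = 1/2"

text \<open>C^n on a set S (S will be open): iterated directional derivatives exist and are
  continuous.\<close>
fun Ck :: "nat \<Rightarrow> 'a::euclidean_space set \<Rightarrow> ('a \<Rightarrow> 'b::real_normed_vector) \<Rightarrow> bool" where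
  "Ck 0 S g = continuous_on S g"
| "Ck (Suc n) S g = (g differentiable_on S \<and>
       (\<forall>v. Ck n S (\<lambda>x. frechet_derivative g (at x) v)))"

definition Dl :: "real \<Rightarrow> ('c::finite,'u::finite,'s::finite) pt set" where
  "Dl R = {(l, x, y). norm x \<le> R \<and> norm y \<le> R}"

definition torus_lift :: "real \<Rightarrow> (('c::finite,'u::finite,'s::finite) pt \<Rightarrow> ('c,'u,'s) pt) \<Rightarrow> bool" where
  "torus_lift R F \<longleftrightarrow> (\<forall>l x y k. (l, x, y) \<in> Dl R \<longrightarrow> intvec k \<longrightarrow>
      (\<exists>k'. intvec k' \<and> F (l + k, x, y) = F (l, x, y) + (k', 0, 0)))"

definition DF :: "(('c::finite,'u::finite,'s::finite) pt \<Rightarrow> ('c,'u,'s) pt) \<Rightarrow> ('c,'u,'s) pt \<Rightarrow> ('c,'u,'s) pt \<Rightarrow> ('c,'u,'s) pt" where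
  "DF F z = frechet_derivative F (at z)"

definition dy_fy where "dy_fy F z = (\<lambda>v. snd (snd (DF F z (0, 0, v))))"
definition dlx_fy where "dlx_fy F z = (\<lambda>(a, b). snd (snd (DF F z (a, b, 0))))"
definition dy_flx where "dy_flx F z = (\<lambda>v. let w = DF F z (0, 0, v) in (fst w, fst (snd w)))"
definition dx_fx where "dx_fx F z = (\<lambda>v. fst (snd (DF F z (0, v, 0))))"
definition dly_fx where "dly_fx F z = (\<lambda>(a, b). fst (snd (DF F z (a, 0, b))))"
definition dx_fly where "dx_fly F z = (\<lambda>v. let w = DF F z (0, v, 0) in (fst w, snd (snd w)))"
definition dly_fly where "dly_fly F z = (\<lambda>(a, b). let w = DF F z (a, 0, b) in (fst w, snd (snd w)))"
definition dlx_flx where "dlx_flx F z = (\<lambda>(a, b). let w = DF F z (a, b, 0) in (fst w, fst (snd w)))"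

definition mnorm :: "('a::real_normed_vector \<Rightarrow> 'b::real_normed_vector) \<Rightarrow> real" where
  "mnorm A = Sup {c. \<forall>v. c * norm v \<le> norm (A v)}"

definition ihull :: "('p \<Rightarrow> 'a::euclidean_space \<Rightarrow> 'b::euclidean_space) \<Rightarrow> 'p set \<Rightarrow> ('a \<Rightarrow> 'b) set" where
  "ihull g U = {A. linear A \<and> (\<forall>i\<in>Basis. \<forall>j\<in>Basis.
      (INF z\<in>U. g z j \<bullet> i) \<le> A j \<bullet> i \<and> A j \<bullet> i \<le> (SUP z\<in>U. g z j \<bullet> i))}"

definition mset :: "('a::real_normed_vector \<Rightarrow> 'b::real_normed_vector) set \<Rightarrow> real" where
  "mset S = (INF A\<in>S. mnorm A)"

definition Pset :: "real \<Rightarrow> ('c::finite,'u::finite,'s::finite) pt \<Rightarrow> ('c,'u,'s) pt set" where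
  "Pset R z = {w \<in> Dl R. norm (fst w - fst z) \<le> RL / 2}"

definition mu_s1 where "mu_s1 R F L = (SUP z\<in>Dl R. onorm (dy_fy F z) + (1/L) * onorm (dlx_fy F z))"
definition mu_s2 where "mu_s2 R F L = (SUP z\<in>Dl R. onorm (dy_fy F z) + L * onorm (dy_flx F z))"
definition xi_u1 where "xi_u1 R F L = (INF z\<in>Dl R. mnorm (dx_fx F z) - (1/L) * onorm (dly_fx F z))"
definition xi_u1P where "xi_u1P R F L =
  (INF z\<in>Dl R. mset (ihull (dx_fx F) (Pset R z))) - (1/L) * (SUP z\<in>Dl R. onorm (dly_fx F z))"
definition xi_u2 where "xi_u2 R F L = (INF z\<in>Dl R. mnorm (dx_fx F z) - L * onorm (dx_fly F z))"
definition mu_cs1 where "mu_cs1 R F L = (SUP z\<in>Dl R. onorm (dly_fly F z) + L * onorm (dx_fly F z))"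
definition mu_cs2 where "mu_cs2 R F L = (SUP z\<in>Dl R. onorm (dly_fly F z) + (1/L) * onorm (dly_fx F z))"
definition xi_cu1 where "xi_cu1 R F L = (INF z\<in>Dl R. mnorm (dlx_flx F z) - L * onorm (dy_flx F z))"
definition xi_cu1P where "xi_cu1P R F L =
  (INF z\<in>Dl R. mset (ihull (dlx_flx F) (Pset R z))) - L * (SUP z\<in>Dl R. onorm (dy_flx F z))"
definition xi_cu2 where "xi_cu2 R F L = (INF z\<in>Dl R. mnorm (dlx_flx F z) - (1/L) * onorm (dlx_fy F z))"

definition rate_conditions where
  "rate_conditions k R F L \<longleftrightarrow>
     0 < xi_u1 R F L \<and> 0 < xi_u1P R F L \<and> 0 < xi_u2 R F L \<and>
     0 < xi_cu1 R F L \<and> 0 < xi_cu1P R F L \<and> 0 < xi_cu2 R F L \<and>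
     mu_s1 R F L < 1 \<and> 1 < xi_u1P R F L \<and>
     mu_cs1 R F L < xi_u1P R F L \<and> mu_s1 R F L < xi_cu1P R F L \<and>
     (\<forall>j::nat. 1 \<le> j \<and> j \<le> k \<longrightarrow>
        mu_cs1 R F L ^ (j + 1) < xi_u2 R F L \<and> mu_s2 R F L < xi_cu1 R F L ^ (j + 1)) \<and>
     mu_cs2 R F L < xi_u1 R F L \<and> mu_s1 R F L < xi_cu2 R F L"

text \<open>Cones, with the lambda-difference taken in some lift (integer translate).\<close>
definition in_Js :: "('c::finite,'u::finite,'s::finite) pt \<Rightarrow> real \<Rightarrow> ('c,'u,'s) pt \<Rightarrow> bool" where
  "in_Js z M w \<longleftrightarrow> (\<exists>k. intvec k \<and>
     norm (fst w + k - fst z, fst (snd w) - fst (snd z)) \<le> M * norm (snd (snd w) - snd (snd z)))"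

definition backward_cone where
  "backward_cone R F L \<longleftrightarrow> (\<forall>z1 z2. z1 \<in> Dl R \<longrightarrow> z2 \<in> Dl R \<longrightarrow> F z1 \<in> Dl R \<longrightarrow> F z2 \<in> Dl R \<longrightarrow>
      in_Js (F z2) (1/L) (F z1) \<longrightarrow> in_Js z2 (1/L) z1)"

text \<open>U = J_u(z,1/L) \<inter> D, taken in the chart of the fixed lift z (J_u(z,1/L) lies in that
  chart since (1/L)*2R < R_Lambda).\<close>
definition Uset :: "real \<Rightarrow> real \<Rightarrow> ('c::finite,'u::finite,'s::finite) pt \<Rightarrow> ('c,'u,'s) pt set" where
  "Uset R L z = {w \<in> Dl R.
     norm (fst w - fst z, snd (snd w) - snd (snd z)) \<le> (1/L) * norm (fst (snd w) - fst (snd z))}"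

definition Dlam :: "real \<Rightarrow> real^'c \<Rightarrow> ('c::finite,'u::finite,'s::finite) pt set" where
  "Dlam R l = cball l RL \<times> cball 0 R \<times> cball 0 R"
definition Dplus :: "real \<Rightarrow> real^'c \<Rightarrow> ('c::finite,'u::finite,'s::finite) pt set" where
  "Dplus R l = cball l RL \<times> cball 0 R \<times> sphere 0 R"
definition Dminus :: "real \<Rightarrow> real^'c \<Rightarrow> ('c::finite,'u::finite,'s::finite) pt set" where
  "Dminus R l = cball l RL \<times> sphere 0 R \<times> ball 0 R"

definition covering where
  "covering R F L \<longleftrightarrow> (\<forall>z \<in> Dl R. \<exists>lstar (h :: real \<times> ('c::finite,'u::finite,'s::finite) pt \<Rightarrow> ('c,'u,'s) pt) A k.
      intvec k \<and> linear A \<and>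
      continuous_on ({0..1} \<times> Uset R L z) h \<and>
      h ` ({0..1} \<times> Uset R L z) \<subseteq> ball lstar RL \<times> UNIV \<and>
      (\<forall>w \<in> Uset R L z. h (0, w) = F w + (k, 0, 0)) \<and>
      (\<forall>\<alpha>\<in>{0..1}. h ` ({\<alpha>} \<times> (Uset R L z \<inter> Dminus R (fst z))) \<inter> Dlam R lstar = {} \<and>
                  h ` ({\<alpha>} \<times> Uset R L z) \<inter> Dplus R lstar = {}) \<and>
      (\<forall>w \<in> Uset R L z. h (1, w) = (lstar, A (fst (snd w)), 0)) \<and>
      A ` sphere 0 R \<subseteq> - cball 0 R)"

definition Wcs :: "real \<Rightarrow> (('c::finite,'u::finite,'s::finite) pt \<Rightarrow> ('c,'u,'s) pt) \<Rightarrow> ('c,'u,'s) pt set" where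
  "Wcs R F = {z. \<forall>n. (F ^^ n) z \<in> Dl R}"

end

theory Submission
  imports Defs
begin

text \<open>For two points of a forward invariant set \<open>W \<subseteq> D\<close> with differences \<open>x\<close> and
  \<open>p = (\<lambda>, y)\<close>, and images with differences \<open>x'\<close> and \<open>p'\<close>, the mean value theorem gives
  \<open>|x'| \<ge> m |x| - b |p|\<close>, with \<open>m\<close> and \<open>b\<close> the two extrema in the definition of \<open>\<xi>\<close>, and
  \<open>|p'| \<le> \<mu>(a) max (|p|, |x| / a)\<close> for every \<open>a > 0\<close>.
  If \<open>W\<close> is an \<open>a\<close>-Lipschitz graph over \<open>p\<close>, then \<open>m |x| - b |p| \<le> |x'| \<le> a |p'| \<le> a \<mu>(a) |p|\<close>,
  so it is also \<open>T(a)\<close>-Lipschitz for \<open>T(a) = (b + a \<mu>(a)) / m\<close>.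
  Now \<open>T(a) < a\<close> says exactly that \<open>\<mu>(a) < \<xi>(a)\<close>; since \<open>a \<mu>(a)\<close> is convex in \<open>a\<close>, this holds on
  all of \<open>[M, L]\<close> as soon as it holds at both endpoints. Hence the best Lipschitz constant, which
  is at most \<open>L\<close> because \<open>\<xi>(L) > 1\<close> and \<open>W\<close> is bounded in \<open>x\<close>, is at most \<open>M\<close>.\<close>

section \<open>Splitting a point into \<open>x\<close> and the pair
  \<open>(\<lambda>, y)\<close>\<close>

definition px :: "('c::finite,'u::finite,'s::finite) pt \<Rightarrow> real^'u" where
  "px z = fst (snd z)"

definition ply :: "('c::finite,'u::finite,'s::finite) pt \<Rightarrow> (real^'c) \<times> (real^'s)" where
  "ply z = (fst z, snd (snd z))"

lemma bounded_linear_px: "bounded_linear px"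
  unfolding px_def[abs_def]
  by (intro bounded_linear_fst_comp bounded_linear_snd_comp bounded_linear_ident)

lemma bounded_linear_ply: "bounded_linear ply"
  unfolding ply_def[abs_def]
  by (intro bounded_linear_Pair bounded_linear_fst_comp bounded_linear_snd_comp
      bounded_linear_ident bounded_linear_fst)

lemma px_diff: "px (a - b) = px a - px b"
  by (simp add: px_def)

lemma ply_add: "ply (a + b) = ply a + ply b"
  by (simp add: ply_def)

lemma norm_px_le: "norm (px z) \<le> norm z" and norm_ply_le: "norm (ply z) \<le> norm z"
  by (auto simp: px_def ply_def norm_prod_def intro!: real_le_rsqrt real_sqrt_le_mono)

lemma Dl_eq: "Dl R = UNIV \<times> cball 0 R \<times> cball 0 R"
  by (auto simp: Dl_def)

lemma convex_Dl: "convex (Dl R)"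
  unfolding Dl_eq by (intro convex_Times convex_UNIV convex_cball)

subsection \<open>Boundedness of the derivative\<close>

text \<open>The integer vector supplied by \<open>torus_lift\<close> may vary with the point. Its
  components are continuous and integer valued on the connected set \<open>Dl R\<close>, hence
  constant; this makes the relation differentiable in \<open>z\<close>.\<close>

lemma translation_defect_constant:
  fixes F :: "('c::finite,'u::finite,'s::finite) pt \<Rightarrow> ('c,'u,'s) pt"
  assumes cont: "continuous_on (Dl R) F" and lift: "torus_lift R F" and k: "intvec k"
  obtains c where "\<And>z. z \<in> Dl R \<Longrightarrow> F (z + (k, 0, 0)) = F z + c"
proof -
  define g where "g z = F (z + (k, 0, 0)) - F z" for z
  have shift: "z + (k, 0, 0) \<in> Dl R" if "z \<in> Dl R" for z
    using that by (cases z) (simp add: Dl_def)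
  have "continuous_on (Dl R) (\<lambda>z. F (z + (k, 0, 0)))"
    by (rule continuous_on_compose2[OF cont, where f="\<lambda>z. z + (k, 0, 0)"]) (use shift in \<open>auto simp del: split_paired_All intro!: continuous_on_add continuous_on_id continuous_on_const\<close>)
  then have cg: "continuous_on (Dl R) g"
    unfolding g_def[abs_def] by (intro continuous_on_diff cont)
  have int: "\<exists>k'. intvec k' \<and> g z = (k', 0, 0)" if "z \<in> Dl R" for z
    using lift that k unfolding torus_lift_def g_def by (cases z) fastforce
  have "(\<lambda>z. fst (g z) $ i) constant_on Dl R" for i
  proof (rule continuous_discrete_range_constant[OF convex_connected[OF convex_Dl]])
    show "continuous_on (Dl R) (\<lambda>z. fst (g z) $ i)" by (intro continuous_intros cg)
    have Z: "fst (g z) $ i \<in> \<int>" if "z \<in> Dl R" for z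
      using int[OF that] by (auto simp: intvec_def)
    show "\<exists>e>0. \<forall>y. y \<in> Dl R \<and> fst (g y) $ i \<noteq> fst (g x) $ i \<longrightarrow>
        e \<le> norm (fst (g y) $ i - fst (g x) $ i)" if "x \<in> Dl R" for x
      using Ints_nonzero_abs_ge1[OF Ints_diff[OF Z Z[OF that]]]
      by (intro exI[of _ 1]) (simp del: split_paired_All)
  qed
  then obtain c where c: "\<And>i z. z \<in> Dl R \<Longrightarrow> fst (g z) $ i = c i"
    unfolding constant_on_def by metis
  have "g z = (\<chi> i. c i, 0, 0)" if "z \<in> Dl R" for z
    using int[OF that] c[OF that] by (auto simp: vec_eq_iff)
  then have "F (z + (k, 0, 0)) = F z + (\<chi> i. c i, 0, 0)" if "z \<in> Dl R" for z
    using that unfolding g_def by (metis add.commute diff_add_cancel)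
  then show thesis by (rule that)
qed

text \<open>Without a bound on the derivative the suprema and infima in the rate conditions would be
  junk; it holds because \<open>DF\<close> is periodic in \<open>\<lambda>\<close>.\<close>

lemma DF_bounded:
  fixes F :: "('c::finite,'u::finite,'s::finite) pt \<Rightarrow> ('c,'u,'s) pt"
  assumes R: "0 < R" and lift: "torus_lift R F"
    and diff: "\<And>z. z \<in> Dl R \<Longrightarrow> (F has_derivative DF F z) (at z)"
    and cont: "\<And>v. continuous_on (Dl R) (\<lambda>z. DF F z v)"
  shows "\<exists>K. \<forall>z \<in> Dl R. \<forall>v. norm (DF F z v) \<le> K * norm v"
proof -
  define D0 :: "('c,'u,'s) pt set" where "D0 = UNIV \<times> ball 0 R \<times> ball 0 R"
  define C :: "('c,'u,'s) pt set" where "C = cbox 0 1 \<times> cball 0 R \<times> cball 0 R"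
  have "open D0" unfolding D0_def by (intro open_Times open_UNIV open_ball)
  have D0D: "D0 \<subseteq> Dl R" by (auto simp: D0_def Dl_def)
  have clD0: "closure D0 = Dl R" unfolding D0_def Dl_eq using R by (simp add: closure_Times)
  have CD: "C \<subseteq> Dl R" by (auto simp: C_def Dl_def)
  have "compact C" unfolding C_def by (intro compact_Times compact_cbox compact_cball)
  have contF: "continuous_on (Dl R) F"
    using diff by (meson continuous_at_imp_continuous_on has_derivative_continuous)
  \<comment> \<open>The relation between \<open>F (z + (k, 0, 0))\<close> and \<open>F z\<close> is
    available on \<open>Dl R\<close> only, so it is differentiated on the interior
    \<open>D0\<close>; continuity recovers the boundary below.\<close>
  have periodic: "DF F (z + (k, 0, 0)) = DF F z" if z: "z \<in> D0" and k: "intvec k" for z k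
  proof -
    obtain c where c: "\<And>z. z \<in> Dl R \<Longrightarrow> F (z + (k, 0, 0)) = F z + c"
      using translation_defect_constant[OF contF lift k] by blast
    have "z + (k, 0, 0) \<in> Dl R" using z D0D by (auto simp: D0_def Dl_def)
    note dk = diff[OF this]
    have "((\<lambda>z. z + (k, 0, 0)) has_derivative (\<lambda>v. v)) (at z)"
      by (auto intro!: derivative_eq_intros)
    from has_derivative_compose[OF this dk]
    have "((\<lambda>z. F (z + (k, 0, 0))) has_derivative DF F (z + (k, 0, 0))) (at z)" .
    then have "((\<lambda>z. F z + c) has_derivative DF F (z + (k, 0, 0))) (at z)"
      by (rule has_derivative_transform_within_open[OF _ \<open>open D0\<close> z]) (use D0D c in auto)
    moreover have "((\<lambda>z. F z + c) has_derivative DF F z) (at z)"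
      by (rule has_derivative_add[OF diff[OF subsetD[OF D0D z]] has_derivative_const, simplified])
    ultimately show ?thesis by (rule has_derivative_unique)
  qed
  have "\<exists>b. \<forall>z \<in> Dl R. norm (DF F z v) \<le> b" for v
  proof -
    have "compact ((\<lambda>z. DF F z v) ` C)"
      using \<open>compact C\<close> continuous_on_subset[OF cont CD] by (rule compact_continuous_image[rotated])
    then have "bounded ((\<lambda>z. DF F z v) ` C)" by (rule compact_imp_bounded)
    then obtain b where "\<forall>x \<in> (\<lambda>z. DF F z v) ` C. norm x \<le> b" unfolding bounded_iff by (elim exE)
    then have b: "norm (DF F z v) \<le> b" if "z \<in> C" for z using that by (rule bspec[OF _ imageI])
    have "norm (DF F z v) \<le> b" if z: "z \<in> D0" for z
    proof -
      obtain l x y where zeq: "z = (l, x, y)" by (cases z)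
      \<comment> \<open>Removing integer parts moves \<open>l\<close> into the unit cube, and so
        \<open>z\<close> into the compact set \<open>C\<close>.\<close>
      define k where "k = (\<chi> i. - real_of_int \<lfloor>l $ i\<rfloor>)"
      have k: "intvec k" by (auto simp: intvec_def k_def)
      have "z + (k, 0, 0) \<in> C"
      proof -
        have "0 \<le> (l + k) $ i \<and> (l + k) $ i \<le> 1" for i
          using floor_correct[of "l $ i"] unfolding k_def by simp linarith
        then have "l + k \<in> cbox 0 1" by (simp add: mem_box_cart)
        then show ?thesis using z unfolding zeq by (simp add: C_def D0_def less_imp_le)
      qed
      from b[OF this] periodic[OF z k] show ?thesis by simp
    qed
    then have "norm (DF F z v) \<le> b" if "z \<in> Dl R" for z
      using continuous_on_closure_norm_le[of D0 "\<lambda>z. DF F z v" b z] cont[of v] that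
      by (simp add: clD0)
    then show ?thesis by blast
  qed
  then obtain b where b: "\<And>z v. z \<in> Dl R \<Longrightarrow> norm (DF F z v) \<le> b v" by metis
  have "norm (DF F z v) \<le> (\<Sum>i\<in>Basis. b i) * norm v" if z: "z \<in> Dl R" for z v
  proof -
    interpret bounded_linear "DF F z" using diff[OF z] by (rule has_derivative_bounded_linear)
    have "DF F z v = DF F z (\<Sum>i\<in>Basis. (v \<bullet> i) *\<^sub>R i)" by (simp add: euclidean_representation)
    also have "\<dots> = (\<Sum>i\<in>Basis. (v \<bullet> i) *\<^sub>R DF F z i)" by (simp add: sum scaleR)
    also have "norm \<dots> \<le> (\<Sum>i\<in>Basis. b i * norm v)"
      by (rule sum_norm_le)
        (use b[OF z] in \<open>auto simp: mult.commute intro!: mult_mono Basis_le_norm\<close>)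
    finally show ?thesis by (simp add: sum_distrib_right)
  qed
  then show ?thesis by blast
qed

subsection \<open>Mean value estimates\<close>

text \<open>For a scalar \<open>P\<close> the mean value theorem gives an equality. The position of
  the intermediate point on the segment is kept, because \<open>px_expansion\<close> has to locate
  it in \<open>Pset\<close>.\<close>

lemma real_mvt_Dl:
  fixes F :: "('c::finite,'u::finite,'s::finite) pt \<Rightarrow> ('c,'u,'s) pt"
    and P :: "('c,'u,'s) pt \<Rightarrow> real"
  assumes diff: "\<And>z. z \<in> Dl R \<Longrightarrow> (F has_derivative DF F z) (at z)"
    and P: "bounded_linear P" and z: "z1 \<in> Dl R" "z2 \<in> Dl R"
  obtains t where "0 < t" "t < 1" "z2 + t *\<^sub>R (z1 - z2) \<in> Dl R"
    "P (F z1 - F z2) = P (DF F (z2 + t *\<^sub>R (z1 - z2)) (z1 - z2))"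
proof -
  define p where "p t = z2 + t *\<^sub>R (z1 - z2)" for t
  have p: "p t \<in> Dl R" if "0 \<le> t" "t \<le> 1" for t
    using convexD_alt[OF convex_Dl z(2,1) that] by (simp add: p_def algebra_simps)
  have d: "((\<lambda>t. P (F (p t))) has_derivative (\<lambda>s. P (DF F (p t) (s *\<^sub>R (z1 - z2))))) (at t)"
    if "0 \<le> t" "t \<le> 1" for t
  proof -
    have "(p has_derivative (\<lambda>s. s *\<^sub>R (z1 - z2))) (at t)"
      unfolding p_def[abs_def] by (auto intro!: derivative_eq_intros)
    from bounded_linear.has_derivative[OF P has_derivative_compose[OF this diff[OF p[OF that]]]]
    show ?thesis .
  qed
  have "\<exists>t\<in>{0<..<1::real}. P (F (p 1)) - P (F (p 0)) = P (DF F (p t) ((1 - 0) *\<^sub>R (z1 - z2)))"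
    by (rule mvt_simple) (auto simp only: zero_less_one intro: has_derivative_at_withinI[OF d])
  then obtain t where "0 < t" "t < 1" "P (F z1 - F z2) = P (DF F (p t) (z1 - z2))"
    by (auto simp: p_def linear_diff[OF bounded_linear.linear[OF P]])
  then show thesis using that[of t] p[of t] by (auto simp: p_def)
qed

text \<open>Testing against the increment \<open>e\<close> itself reduces to the scalar case; after
  Cauchy-Schwarz one factor \<open>norm e\<close> cancels.\<close>

lemma norm_mvt_Dl:
  fixes F :: "('c::finite,'u::finite,'s::finite) pt \<Rightarrow> ('c,'u,'s) pt"
    and P :: "('c,'u,'s) pt \<Rightarrow> 'b::real_inner"
  assumes diff: "\<And>z. z \<in> Dl R \<Longrightarrow> (F has_derivative DF F z) (at z)"
    and P: "bounded_linear P" and z: "z1 \<in> Dl R" "z2 \<in> Dl R"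
  obtains z where "z \<in> Dl R" "norm (P (F z1 - F z2)) \<le> norm (P (DF F z (z1 - z2)))"
proof -
  define e where "e = P (F z1 - F z2)"
  have "bounded_linear (\<lambda>w. P w \<bullet> e)"
    by (rule bounded_linear_compose[OF bounded_linear_inner_left P])
  from real_mvt_Dl[OF diff this z] obtain z where z: "z \<in> Dl R" "e \<bullet> e = P (DF F z (z1 - z2)) \<bullet> e"
    unfolding e_def by metis
  have "norm e * norm e \<le> norm (P (DF F z (z1 - z2))) * norm e"
    using norm_cauchy_schwarz[of "P (DF F z (z1 - z2))" e] z(2)
    by (simp add: power2_norm_eq_inner flip: power2_eq_square)
  then have "norm e \<le> norm (P (DF F z (z1 - z2)))"
    by (cases "e = 0") auto
  with z(1) show thesis unfolding e_def by (rule that)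
qed

subsection \<open>The constants in the rate conditions\<close>

lemma mnorm_props:
  fixes A :: "'a::euclidean_space \<Rightarrow> 'b::real_normed_vector"
  shows mnorm_nonneg: "0 \<le> mnorm A"
    and mnorm_le: "mnorm A * norm v \<le> norm (A v)"
proof -
  let ?S = "{c. \<forall>v. c * norm v \<le> norm (A v)}"
  have ub: "c \<le> norm (A v) / norm v" if "c \<in> ?S" "v \<noteq> 0" for c v
    using that by (auto simp: field_simps)
  have 0: "0 \<in> ?S" by simp
  \<comment> \<open>A nonzero vector is what bounds the set above, so that its \<open>Sup\<close> is
    a genuine supremum.\<close>
  obtain b :: 'a where "b \<noteq> 0" using nonzero_Basis nonempty_Basis by blast
  with ub have "bdd_above ?S" by (intro bdd_aboveI[of _ "norm (A b) / norm b"]) blast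
  with 0 show "0 \<le> mnorm A" unfolding mnorm_def by (rule cSup_upper)
  show "mnorm A * norm v \<le> norm (A v)"
  proof (cases "v = 0")
    case False
    with 0 ub have "mnorm A \<le> norm (A v) / norm v"
      unfolding mnorm_def by (intro cSup_least) blast+
    with False show ?thesis by (simp add: field_simps)
  qed simp
qed

context
  fixes F :: "('c::finite,'u::finite,'s::finite) pt \<Rightarrow> ('c,'u,'s) pt" and R K :: real
  assumes R: "0 < R"
    and diff: "\<And>z. z \<in> Dl R \<Longrightarrow> (F has_derivative DF F z) (at z)"
    and bound: "\<And>z v. z \<in> Dl R \<Longrightarrow> norm (DF F z v) \<le> K * norm v"
begin

lemma zero_in_Dl: "0 \<in> Dl R"
  using R by (auto simp: Dl_def zero_prod_def)

lemma DF_linear: "z \<in> Dl R \<Longrightarrow> bounded_linear (DF F z)"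
  using diff has_derivative_bounded_linear by blast

lemma dly_fx_eq: "dly_fx F z p = px (DF F z (fst p, 0, snd p))"
  and dx_fx_eq: "dx_fx F z x = px (DF F z (0, x, 0))"
  and dly_fly_eq: "dly_fly F z p = ply (DF F z (fst p, 0, snd p))"
  and dx_fly_eq: "dx_fly F z x = ply (DF F z (0, x, 0))"
  by (simp_all add: dly_fx_def dx_fx_def dly_fly_def dx_fly_def px_def ply_def Let_def split_beta)

lemma bounded_linear_embeddings:
  "bounded_linear (\<lambda>p :: (real^'c) \<times> (real^'s). (fst p, 0 :: real^'u, snd p))"
  "bounded_linear (\<lambda>x :: real^'u. (0 :: real^'c, x, 0 :: real^'s))"
  by (intro bounded_linear_Pair bounded_linear_fst bounded_linear_snd bounded_linear_zero
      bounded_linear_ident)+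

lemma norm_embeddings [simp]:
  "norm (fst p, 0 :: real^'u, snd p) = norm p"
  "norm (0 :: real^'c, x :: real^'u, 0 :: real^'s) = norm x"
  by (simp_all add: norm_prod_def)

lemma partial_linear:
  assumes "z \<in> Dl R"
  shows "bounded_linear (dly_fx F z)" "bounded_linear (dx_fx F z)"
    "bounded_linear (dly_fly F z)" "bounded_linear (dx_fly F z)"
  unfolding dly_fx_eq[abs_def] dx_fx_eq[abs_def] dly_fly_eq[abs_def] dx_fly_eq[abs_def]
  by (intro bounded_linear_compose[OF bounded_linear_px]
      bounded_linear_compose[OF bounded_linear_ply]
      bounded_linear_compose[OF DF_linear[OF assms]] bounded_linear_embeddings)+

lemma partial_bound:
  assumes "z \<in> Dl R"
  shows "norm (dly_fx F z p) \<le> K * norm p" "norm (dx_fx F z x) \<le> K * norm x"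
    "norm (dly_fly F z p) \<le> K * norm p" "norm (dx_fly F z x) \<le> K * norm x"
  unfolding dly_fx_eq dx_fx_eq dly_fly_eq dx_fly_eq
  using bound[OF assms, of "(fst p, 0, snd p)"] bound[OF assms, of "(0, x, 0)"]
  by (auto simp only: norm_embeddings intro: order_trans[OF norm_px_le] order_trans[OF norm_ply_le])

lemma onorm_dly_fx_le_SUP: "z \<in> Dl R \<Longrightarrow> onorm (dly_fx F z) \<le> (SUP z\<in>Dl R. onorm (dly_fx F z))"
  by (rule cSUP_upper, assumption, rule bdd_aboveI2[of _ _ K], rule onorm_le, rule partial_bound)

text \<open>The weight \<open>a\<close> is free here and in \<open>xi_u1P\<close>:
  \<open>a = L\<close> gives the quantities of the rate conditions, \<open>a = M\<close> the \<mu>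
  and \<xi> of the theorem.\<close>

lemma mu_cs1_upper:
  assumes a: "0 \<le> a" and z: "z \<in> Dl R"
  shows "onorm (dly_fly F z) + a * onorm (dx_fly F z) \<le> mu_cs1 R F a"
  unfolding mu_cs1_def
  by (rule cSUP_upper[OF z], rule bdd_aboveI2[of _ _ "K + a * K"])
    (intro add_mono mult_left_mono onorm_le partial_bound a, assumption+)

lemma mu_cs1_nonneg: "0 \<le> a \<Longrightarrow> 0 \<le> mu_cs1 R F a"
  by (rule order_trans[OF _ mu_cs1_upper[OF _ zero_in_Dl]])
    (simp_all add: onorm_pos_le partial_linear zero_in_Dl)

text \<open>The common bound \<open>t\<close> serves two uses: \<open>t = |x| / a\<close> for
  differences inside the unstable cone, \<open>t = |p|\<close> for differences on a Lipschitz
  graph.\<close>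

lemma ply_expansion:
  assumes z: "z1 \<in> Dl R" "z2 \<in> Dl R" and a: "0 \<le> a"
    and t: "norm (ply (z1 - z2)) \<le> t" "norm (px (z1 - z2)) \<le> a * t"
  shows "norm (ply (F z1 - F z2)) \<le> mu_cs1 R F a * t"
proof -
  obtain z where z: "z \<in> Dl R"
    and le: "norm (ply (F z1 - F z2)) \<le> norm (ply (DF F z (z1 - z2)))"
    using norm_mvt_Dl[OF diff bounded_linear_ply z] by blast
  define p x where "p = ply (z1 - z2)" and "x = px (z1 - z2)"
  have "z1 - z2 = (fst p, 0, snd p) + (0, x, 0)"
    by (simp add: p_def x_def ply_def px_def prod_eq_iff)
  then have "ply (DF F z (z1 - z2)) = dly_fly F z p + dx_fly F z x"
    by (simp add: dly_fly_eq dx_fly_eq linear_add[OF bounded_linear.linear[OF DF_linear[OF z]]] ply_add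
        del: add_Pair)
  also have "norm \<dots> \<le> onorm (dly_fly F z) * norm p + onorm (dx_fly F z) * norm x"
    by (intro norm_triangle_mono onorm partial_linear[OF z])
  also have "\<dots> \<le> onorm (dly_fly F z) * t + onorm (dx_fly F z) * (a * t)"
    using t by (intro add_mono mult_left_mono onorm_pos_le partial_linear[OF z]) (simp_all add: p_def x_def)
  also have "\<dots> = (onorm (dly_fly F z) + a * onorm (dx_fly F z)) * t"
    by (simp add: algebra_simps)
  also have "\<dots> \<le> mu_cs1 R F a * t"
    using t(1) norm_ge_zero[of "ply (z1 - z2)"]
    by (intro mult_right_mono mu_cs1_upper a z) linarith
  finally show ?thesis using le by linarith
qed

lemma mset_ihull_le:
  assumes "A \<in> ihull (dx_fx F) (Pset R z)"
  shows "mset (ihull (dx_fx F) (Pset R z)) \<le> mnorm A"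
  unfolding mset_def using assms by (intro cINF_lower bdd_belowI[of _ 0]) (auto intro: mnorm_nonneg)

lemma dx_fx_entry_bounds:
  assumes z: "z' \<in> Pset R z" and ij: "i \<in> Basis" "j \<in> Basis"
  shows "(INF z\<in>Pset R z. dx_fx F z j \<bullet> i) \<le> dx_fx F z' j \<bullet> i"
    and "dx_fx F z' j \<bullet> i \<le> (SUP z\<in>Pset R z. dx_fx F z j \<bullet> i)"
proof -
  have b: "\<bar>dx_fx F w j \<bullet> i\<bar> \<le> K" if "w \<in> Pset R z" for w
  proof -
    have "w \<in> Dl R" using that unfolding Pset_def by blast
    from partial_bound(2)[OF this, of j] show ?thesis
      using Basis_le_norm[OF ij(1), of "dx_fx F w j"] ij(2) by simp
  qed
  show "(INF z\<in>Pset R z. dx_fx F z j \<bullet> i) \<le> dx_fx F z' j \<bullet> i"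
    by (rule cINF_lower[OF _ z], rule bdd_belowI[of _ "- K"]) (use b abs_le_D2 in fastforce)
  show "dx_fx F z' j \<bullet> i \<le> (SUP z\<in>Pset R z. dx_fx F z j \<bullet> i)"
    by (rule cSUP_upper[OF z], rule bdd_aboveI[of _ K]) (use b abs_le_D1 in fastforce)
qed

lemma dx_fx_in_ihull:
  assumes "z' \<in> Pset R z"
  shows "dx_fx F z' \<in> ihull (dx_fx F) (Pset R z)"
proof -
  have "z' \<in> Dl R" using assms unfolding Pset_def by blast
  then have "linear (dx_fx F z')" by (intro bounded_linear.linear partial_linear)
  with dx_fx_entry_bounds[OF assms] show ?thesis unfolding ihull_def by blast
qed

lemma INF_mset_le:
  assumes z: "z \<in> Dl R" and A: "A \<in> ihull (dx_fx F) (Pset R z)"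
  shows "(INF z\<in>Dl R. mset (ihull (dx_fx F) (Pset R z))) \<le> mnorm A"
proof -
  have "0 \<le> mset (ihull (dx_fx F) (Pset R z))" if "z \<in> Dl R" for z
  proof -
    \<comment> \<open>The hull must be nonempty for its infimum to be meaningful.\<close>
    have "dx_fx F z \<in> ihull (dx_fx F) (Pset R z)"
      using that by (intro dx_fx_in_ihull) (simp add: Pset_def RL_def)
    then show ?thesis unfolding mset_def by (intro cINF_greatest mnorm_nonneg) auto
  qed
  then have "(INF z\<in>Dl R. mset (ihull (dx_fx F) (Pset R z))) \<le> mset (ihull (dx_fx F) (Pset R z))"
    by (intro cINF_lower z bdd_belowI[of _ 0]) auto
  also have "\<dots> \<le> mnorm A" using A by (rule mset_ihull_le)
  finally show ?thesis .
qed

text \<open>Expansion needs a lower bound, which \<open>norm_mvt_Dl\<close> cannot give. For the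
  \<open>x\<close> part it comes from an exact identity \<open>x' = A x\<close> with
  \<open>A\<close> in the interval hull; only the \<open>(\<lambda>, y)\<close> part is estimated by
  an operator norm.\<close>

lemma px_expansion:
  assumes z: "z1 \<in> Dl R" "z2 \<in> Dl R"
  shows "(INF z\<in>Dl R. mset (ihull (dx_fx F) (Pset R z))) * norm (px (z1 - z2))
      - (SUP z\<in>Dl R. onorm (dly_fx F z)) * norm (ply (z1 - z2)) \<le> norm (px (F z1 - F z2))"
proof -
  \<comment> \<open>Changing \<open>x\<close> first keeps \<open>\<lambda>\<close> fixed on that segment, which therefore lies in \<open>P(z1)\<close>
    however far apart the two points are.\<close>
  define z3 where "z3 = (fst z1, px z2, snd (snd z1))"
  define p x where "p = ply (z1 - z2)" and "x = px (z1 - z2)"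
  have z3: "z3 \<in> Dl R" using z by (auto simp: z3_def Dl_def px_def)
  have z13: "z1 - z3 = (0, x, 0)" and z32: "z3 - z2 = (fst p, 0, snd p)"
    by (auto simp: z3_def x_def p_def px_def ply_def prod_eq_iff)

  obtain zb where "zb \<in> Dl R" "norm (px (F z3 - F z2)) \<le> norm (px (DF F zb (z3 - z2)))"
    using norm_mvt_Dl[OF diff bounded_linear_px z3 z(2)] by blast
  then have "norm (px (F z3 - F z2)) \<le> norm (dly_fx F zb p)" by (simp add: z32 dly_fx_eq)
  also have "\<dots> \<le> onorm (dly_fx F zb) * norm p"
    using \<open>zb \<in> Dl R\<close> by (intro onorm partial_linear)
  also have "\<dots> \<le> (SUP z\<in>Dl R. onorm (dly_fx F z)) * norm p"
    using \<open>zb \<in> Dl R\<close> by (intro mult_right_mono onorm_dly_fx_le_SUP) auto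
  finally have B: "norm (px (F z3 - F z2)) \<le> (SUP z\<in>Dl R. onorm (dly_fx F z)) * norm p" .

  \<comment> \<open>The rows of \<open>A\<close> come from different intermediate points, which the interval hull permits.\<close>
  have "\<exists>w\<in>Pset R z1. px (F z1 - F z3) \<bullet> i = dx_fx F w x \<bullet> i" for i
  proof -
    have "bounded_linear (\<lambda>w. px w \<bullet> i)"
      by (rule bounded_linear_compose[OF bounded_linear_inner_left bounded_linear_px])
    from real_mvt_Dl[OF diff this z(1) z3] obtain t where
      t: "z3 + t *\<^sub>R (z1 - z3) \<in> Dl R"
      "px (F z1 - F z3) \<bullet> i = px (DF F (z3 + t *\<^sub>R (z1 - z3)) (z1 - z3)) \<bullet> i" by metis
    have "z3 + t *\<^sub>R (z1 - z3) \<in> Pset R z1"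
      using t(1) unfolding Pset_def z13 by (simp add: z3_def RL_def)
    then show ?thesis using t(2) unfolding z13 dx_fx_eq by blast
  qed
  then obtain w where w: "\<And>i. w i \<in> Pset R z1"
    and weq: "\<And>i. px (F z1 - F z3) \<bullet> i = dx_fx F (w i) x \<bullet> i" by metis
  define A where "A v = (\<Sum>i\<in>Basis. (dx_fx F (w i) v \<bullet> i) *\<^sub>R i)" for v
  have Ai: "A v \<bullet> i = dx_fx F (w i) v \<bullet> i" if "i \<in> Basis" for v i
    unfolding A_def using that by simp
  have wD: "w i \<in> Dl R" for i using w[of i] unfolding Pset_def by blast
  have "linear (dx_fx F (w i))" for i
    by (rule bounded_linear.linear[OF partial_linear(2)[OF wD]])
  then have "linear A"
    by (auto intro!: linearI euclidean_eqI[where 'a="real^'u"]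
        simp: Ai linear_add linear_cmul inner_add_left)
  then have "A \<in> ihull (dx_fx F) (Pset R z1)"
    unfolding ihull_def using dx_fx_entry_bounds[OF w] by (auto simp: Ai)
  have "px (F z1 - F z3) = A x"
    by (rule euclidean_eqI) (simp add: Ai weq)
  moreover have "(INF z\<in>Dl R. mset (ihull (dx_fx F) (Pset R z))) * norm x \<le> mnorm A * norm x"
    by (intro mult_right_mono INF_mset_le[OF z(1)] \<open>A \<in> _\<close>) simp
  ultimately have "(INF z\<in>Dl R. mset (ihull (dx_fx F) (Pset R z))) * norm x \<le> norm (px (F z1 - F z3))"
    using mnorm_le[of A x] by simp
  moreover have "norm (px (F z1 - F z3)) - norm (px (F z3 - F z2)) \<le> norm (px (F z1 - F z2))"
    using norm_diff_ineq[of "px (F z1 - F z3)" "px (F z3 - F z2)"] by (simp add: px_diff)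
  ultimately show ?thesis
    using B unfolding p_def x_def by linarith
qed

text \<open>\<open>a * mu_cs1 R F a\<close> is a supremum of quadratics
  \<open>a * C + a^2 * E\<close> with \<open>E \<ge> 0\<close>, hence convex. The chord inequality
  is multiplied by \<open>N - M\<close>, which also covers \<open>N = M\<close>.\<close>

lemma mu_cs1_chord:
  assumes M: "0 < M" "M \<le> a" "a \<le> N"
  shows "(N - M) * (a * mu_cs1 R F a) \<le> (N - a) * (M * mu_cs1 R F M) + (a - M) * (N * mu_cs1 R F N)"
    (is "_ \<le> ?c")
proof (cases "M < N")
  case True
  have "onorm (dly_fly F z) + a * onorm (dx_fly F z) \<le> ?c / ((N - M) * a)" if z: "z \<in> Dl R" for z
  proof -
    define C E where "C = onorm (dly_fly F z)" and "E = onorm (dx_fly F z)"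
    have "0 \<le> E" unfolding E_def by (intro onorm_pos_le partial_linear z)
    \<comment> \<open>The terms in \<open>C\<close> are linear and agree with their chord; the
      remainder is the gap between \<open>a^2\<close> and its chord.\<close>
    have "(N - M) * a * (C + a * E) = (N - a) * (M * (C + M * E)) + (a - M) * (N * (C + N * E))
        - (N - M) * (a - M) * (N - a) * E"
      by (simp add: algebra_simps)
    also have "\<dots> \<le> (N - a) * (M * (C + M * E)) + (a - M) * (N * (C + N * E))"
      using M True \<open>0 \<le> E\<close> by simp
    also have "\<dots> \<le> ?c"
      unfolding C_def E_def using M True
      by (intro add_mono mult_left_mono mu_cs1_upper z) auto
    finally show ?thesis
      using M True by (simp add: C_def E_def pos_le_divide_eq mult.commute)
  qed
  then have "mu_cs1 R F a \<le> ?c / ((N - M) * a)"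
    unfolding mu_cs1_def[of R F a] using zero_in_Dl by (intro cSUP_least) auto
  then show ?thesis using M True by (simp add: pos_le_divide_eq mult_ac)
next
  case False
  then have "N = M" "a = M" using M by auto
  then show ?thesis by simp
qed

subsection \<open>Lipschitz constants of forward invariant sets\<close>

lemma SUP_dly_fx_nonneg: "0 \<le> (SUP z\<in>Dl R. onorm (dly_fx F z))"
  using onorm_dly_fx_le_SUP[OF zero_in_Dl] onorm_pos_le[OF partial_linear(1)[OF zero_in_Dl]]
  by linarith

text \<open>Two points violating the estimate stay in each other's unstable cone under iteration, and
  their \<open>x\<close>-distance grows geometrically, which is impossible in the bounded set \<open>D\<close>.\<close>

lemma invariant_set_lipschitz:
  assumes inv: "\<And>z. z \<in> W \<Longrightarrow> F z \<in> W" and W: "W \<subseteq> Dl R"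
    and a: "0 < a" and xi: "1 < xi_u1P R F a" "mu_cs1 R F a \<le> xi_u1P R F a"
    and z: "z1 \<in> W" "z2 \<in> W"
  shows "norm (px (z1 - z2)) \<le> a * norm (ply (z1 - z2))"
proof (rule ccontr)
  assume "\<not> ?thesis"
  then have gt: "a * norm (ply (z1 - z2)) < norm (px (z1 - z2))" by simp
  let ?\<xi> = "xi_u1P R F a"
  define d where "d n = (F ^^ n) z1 - (F ^^ n) z2" for n
  have iter: "(F ^^ n) z1 \<in> W" "(F ^^ n) z2 \<in> W" for n
    by (induction n) (auto intro: inv z)
  have step: "a * norm (ply (d n)) \<le> norm (px (d n)) \<and> ?\<xi> ^ n * norm (px (d 0)) \<le> norm (px (d n))" for n
  proof (induction n)
    case 0
    show ?case using gt by (simp add: d_def)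
  next
    case (Suc n)
    define p x where "p = norm (ply (d n))" and "x = norm (px (d n))"
    have dS: "d (Suc n) = F ((F ^^ n) z1) - F ((F ^^ n) z2)" by (simp add: d_def)
    have D: "(F ^^ n) z1 \<in> Dl R" "(F ^^ n) z2 \<in> Dl R" using iter W by auto
    have p: "p \<le> x / a" using Suc a by (simp add: p_def x_def pos_le_divide_eq mult.commute)
    \<comment> \<open>Inside the cone the loss \<open>b * p\<close> is at most
      \<open>(b / a) * x\<close>, which turns the factor \<open>m\<close> into \<xi>.\<close>
    have "(SUP z\<in>Dl R. onorm (dly_fx F z)) * p \<le> (SUP z\<in>Dl R. onorm (dly_fx F z)) * (x / a)"
      by (intro mult_left_mono p SUP_dly_fx_nonneg)
    then have x: "?\<xi> * x \<le> norm (px (d (Suc n)))"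
      using px_expansion[OF D] unfolding dS xi_u1P_def p_def x_def d_def
      by (simp add: left_diff_distrib)
    have "norm (ply (d (Suc n))) \<le> mu_cs1 R F a * (x / a)"
      unfolding dS by (rule ply_expansion[OF D]) (use a p in \<open>auto simp: p_def x_def d_def\<close>)
    then have "a * norm (ply (d (Suc n))) \<le> mu_cs1 R F a * x"
      using a by (simp add: field_simps)
    \<comment> \<open>Cone invariance: contraction by \<mu> and expansion by \<xi> \<ge> \<mu> keep
      \<open>a * |p'| \<le> |x'|\<close>.\<close>
    also have "\<dots> \<le> ?\<xi> * x" by (intro mult_right_mono xi) (simp add: x_def)
    finally have "a * norm (ply (d (Suc n))) \<le> norm (px (d (Suc n)))" using x by linarith
    moreover have "?\<xi> ^ Suc n * norm (px (d 0)) \<le> ?\<xi> * x"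
      using mult_left_mono[of "?\<xi> ^ n * norm (px (d 0))" x ?\<xi>] Suc xi(1) by (simp add: x_def)
    ultimately show ?case using x by linarith
  qed
  have pos: "0 < norm (px (d 0))"
    using le_less_trans[OF mult_nonneg_nonneg[OF less_imp_le[OF a] norm_ge_zero] gt]
    by (simp add: d_def)
  \<comment> \<open>\<open>2 * R\<close> bounds the \<open>x\<close>-distance of any two points of
    \<open>Dl R\<close>.\<close>
  obtain n where n: "2 * R / norm (px (d 0)) < ?\<xi> ^ n"
    using real_arch_pow[OF xi(1)] by blast
  have "norm (px (d n)) \<le> norm (px ((F ^^ n) z1)) + norm (px ((F ^^ n) z2))"
    unfolding d_def px_diff by (rule norm_triangle_ineq4)
  moreover have "norm (px ((F ^^ n) z1)) \<le> R" "norm (px ((F ^^ n) z2)) \<le> R"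
    using iter[of n] W by (auto simp: Dl_def px_def)
  ultimately have "norm (px (d n)) \<le> 2 * R" by linarith
  with step[of n] n pos show False by (simp add: pos_divide_less_eq)
qed

text \<open>One graph transform step: the hypothesis is applied to the images, which remain in
  \<open>W\<close>. Division by the factor on the left yields \<open>T(a)\<close>.\<close>

lemma lipschitz_improvement:
  assumes inv: "\<And>z. z \<in> W \<Longrightarrow> F z \<in> W" and W: "W \<subseteq> Dl R" and a: "0 < a"
    and lip: "\<And>z1 z2. z1 \<in> W \<Longrightarrow> z2 \<in> W \<Longrightarrow> norm (px (z1 - z2)) \<le> a * norm (ply (z1 - z2))"
    and z: "z1 \<in> W" "z2 \<in> W"
  shows "(INF z\<in>Dl R. mset (ihull (dx_fx F) (Pset R z))) * norm (px (z1 - z2))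
    \<le> ((SUP z\<in>Dl R. onorm (dly_fx F z)) + a * mu_cs1 R F a) * norm (ply (z1 - z2))"
proof -
  have D: "z1 \<in> Dl R" "z2 \<in> Dl R" using z W by auto
  have "norm (px (F z1 - F z2)) \<le> a * norm (ply (F z1 - F z2))"
    by (intro lip inv z)
  also have "\<dots> \<le> a * (mu_cs1 R F a * norm (ply (z1 - z2)))"
    using a by (intro mult_left_mono ply_expansion[OF D] lip z) auto
  finally show ?thesis using px_expansion[OF D] by (simp add: algebra_simps)
qed

text \<open>Rather than iterating \<open>T\<close>, the proof takes the infimum \<open>c\<close> of
  the admissible constants in \<open>[M, N]\<close>, shows that it is attained, and improves it once
  more.\<close>

lemma invariant_set_lipschitz_descent:
  assumes inv: "\<And>z. z \<in> W \<Longrightarrow> F z \<in> W" and W: "W \<subseteq> Dl R"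
    and M: "0 < M" "M \<le> N"
    and lipN: "\<And>z1 z2. z1 \<in> W \<Longrightarrow> z2 \<in> W \<Longrightarrow> norm (px (z1 - z2)) \<le> N * norm (ply (z1 - z2))"
    and rateM: "mu_cs1 R F M < xi_u1P R F M" and rateN: "mu_cs1 R F N < xi_u1P R F N"
    and z: "z1 \<in> W" "z2 \<in> W"
  shows "norm (px (z1 - z2)) \<le> M * norm (ply (z1 - z2))"
proof -
  define m where "m = (INF z\<in>Dl R. mset (ihull (dx_fx F) (Pset R z)))"
  define b where "b = (SUP z\<in>Dl R. onorm (dly_fx F z))"
  define lip where
    "lip a \<longleftrightarrow> (\<forall>z1\<in>W. \<forall>z2\<in>W. norm (px (z1 - z2)) \<le> a * norm (ply (z1 - z2)))" for a
  have xi: "xi_u1P R F a = m - b / a" for a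
    by (simp add: xi_u1P_def m_def b_def)
  have b: "0 \<le> b" unfolding b_def by (rule SUP_dly_fx_nonneg)
  have "0 < xi_u1P R F M" using rateM mu_cs1_nonneg[of M] M by linarith
  moreover have "0 \<le> b / M" using b M by simp
  ultimately have m: "0 < m" unfolding xi by linarith
  have gapM: "M * mu_cs1 R F M < m * M - b" and gapN: "N * mu_cs1 R F N < m * N - b"
    using rateM rateN M by (simp_all add: xi field_simps)
  have gap: "b + a * mu_cs1 R F a < m * a" if a: "M \<le> a" "a \<le> N" for a
  proof (cases "a = M")
    case True
    then show ?thesis using gapM by simp
  next
    case False
    have "(N - M) * (a * mu_cs1 R F a) \<le> (N - a) * (M * mu_cs1 R F M) + (a - M) * (N * mu_cs1 R F N)"
      using mu_cs1_chord M a by blast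
    \<comment> \<open>Strictness comes from the endpoint \<open>N\<close>, whose weight
      \<open>a - M\<close> is positive.\<close>
    also have "\<dots> < (N - a) * (m * M - b) + (a - M) * (m * N - b)"
      using False a gapM gapN by (intro add_le_less_mono mult_left_mono mult_strict_left_mono) auto
    also have "\<dots> = (N - M) * (m * a - b)" by (simp add: algebra_simps)
    finally show ?thesis using False a by (simp add: mult_less_cancel_left)
  qed
  define S where "S = {a. M \<le> a \<and> a \<le> N \<and> lip a}"
  define c where "c = Inf S"
  have NS: "N \<in> S" using lipN M by (auto simp: S_def lip_def)
  have bdd: "bdd_below S" by (auto simp: S_def intro: bdd_belowI)
  have c: "M \<le> c" "c \<le> N"
    unfolding c_def using NS bdd by (auto intro!: cInf_greatest cInf_lower simp: S_def)
  have "lip c"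
    unfolding lip_def
  proof (intro ballI)
    fix z1 z2 assume z: "z1 \<in> W" "z2 \<in> W"
    show "norm (px (z1 - z2)) \<le> c * norm (ply (z1 - z2))"
    \<comment> \<open>With equal \<open>(\<lambda>, y)\<close> there is no quotient to bound by
      \<open>c\<close>; the estimate with \<open>N\<close> already forces equal
      \<open>x\<close>.\<close>
    proof (cases "ply (z1 - z2) = 0")
      case True
      then show ?thesis using lipN[OF z] by simp
    next
      case False
      have "norm (px (z1 - z2)) / norm (ply (z1 - z2)) \<le> c"
        unfolding c_def
      proof (rule cInf_greatest)
        fix a assume "a \<in> S"
        then have "norm (px (z1 - z2)) \<le> a * norm (ply (z1 - z2))"
          using z unfolding S_def lip_def by blast
        then show "norm (px (z1 - z2)) / norm (ply (z1 - z2)) \<le> a"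
          using False by (simp add: pos_divide_le_eq)
      qed (use NS in auto)
      then show ?thesis using False by (simp add: pos_divide_le_eq)
    qed
  qed
  define T where "T = (b + c * mu_cs1 R F c) / m"
  have "T < c" using gap[OF c] m by (simp add: T_def pos_divide_less_eq mult.commute)
  have "lip T"
    unfolding lip_def
  proof (intro ballI)
    fix z1 z2 assume z: "z1 \<in> W" "z2 \<in> W"
    have "m * norm (px (z1 - z2)) \<le> (b + c * mu_cs1 R F c) * norm (ply (z1 - z2))"
      unfolding m_def b_def
      by (rule lipschitz_improvement[OF inv W])
        (use c M z \<open>lip c\<close> in \<open>unfold lip_def, linarith | blast\<close>)+
    then show "norm (px (z1 - z2)) \<le> T * norm (ply (z1 - z2))"
      using m by (simp add: T_def pos_le_divide_eq mult.commute)
  qed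
  have lip_mono: "lip b" if "lip a" "a \<le> b" for a b
    using that unfolding lip_def by (meson mult_right_mono norm_ge_zero order_trans)
  \<comment> \<open>\<open>T\<close> may drop below \<open>M\<close>, so it is cut off there. As
    \<open>T < c\<close>, minimality of \<open>c\<close> then leaves only
    \<open>c = M\<close>.\<close>
  have "max M T \<in> S"
    using lip_mono[OF \<open>lip T\<close>, of "max M T"] c \<open>T < c\<close> by (simp add: S_def)
  then have "c \<le> max M T" unfolding c_def using bdd by (rule cInf_lower)
  with \<open>T < c\<close> c have "c = M" by linarith
  with \<open>lip c\<close> z show ?thesis by (simp add: lip_def)
qed

end

section \<open>From smoothness and rate conditions to the theorem\<close>

lemma DF_of_C2:
  assumes "open U" "Dl R \<subseteq> U" "Ck (Suc k) U F" "1 \<le> k"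
  shows "z \<in> Dl R \<Longrightarrow> (F has_derivative DF F z) (at z)"
    and "continuous_on (Dl R) (\<lambda>z. DF F z v)"
proof -
  have "F differentiable_on U" using assms by simp
  show "(F has_derivative DF F z) (at z)" if "z \<in> Dl R"
    using \<open>F differentiable_on U\<close> subsetD[OF assms(2) that]
    by (simp add: DF_def differentiable_on_eq_differentiable_at[OF assms(1)] flip: frechet_derivative_works)
  \<comment> \<open>The second level of \<open>Ck\<close> makes each directional derivative
    differentiable, hence continuous.\<close>
  obtain k' where "k = Suc k'" using assms(4) by (cases k) auto
  then have "(\<lambda>z. DF F z v) differentiable_on U"
    using assms(3) by (simp add: DF_def del: split_paired_All)
  then show "continuous_on (Dl R) (\<lambda>z. DF F z v)"
    using differentiable_imp_continuous_on continuous_on_subset assms(2) by blast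
qed

theorem theorem3p5:
  fixes F :: "('c::finite,'u::finite,'s::finite) pt \<Rightarrow> ('c,'u,'s) pt"
    and R L M :: real and k :: nat
    and w :: "real^'c \<Rightarrow> real^'s \<Rightarrow> real^'u"
  assumes R: "0 < R" "R < RL / 2"
    and L: "2 * R / RL < L" "L < 1"
    and k: "1 \<le> k"
    and lift: "torus_lift R F"
    and smooth: "\<exists>U. open U \<and> Dl R \<subseteq> U \<and> Ck (Suc k) U F"
    and cov: "covering R F L"
    and rate: "rate_conditions k R F L"
    and cone: "backward_cone R F L"
    and graph: "Wcs R F = {(l, w l y, y) | l y. norm y \<le> R}"
    and M: "0 < M" "M < L"
    and ratio: "xi_u1P R F M / mu_cs1 R F M > 1"
  shows "\<forall>l1 l2 y1 y2. norm y1 \<le> R \<longrightarrow> norm y2 \<le> R \<longrightarrow> norm (l1 - l2) \<le> RL \<longrightarrow>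
           norm (w l1 y1 - w l2 y2) \<le> M * norm (l1 - l2, y1 - y2)"
proof (intro allI impI)
  fix l1 l2 :: "real^'c" and y1 y2 :: "real^'s"
  assume y: "norm y1 \<le> R" "norm y2 \<le> R"
  obtain U where U: "open U" "Dl R \<subseteq> U" "Ck (Suc k) U F" using smooth by blast
  note diff = DF_of_C2(1)[OF U k] and cont = DF_of_C2(2)[OF U k]
  obtain K where "\<forall>z \<in> Dl R. \<forall>v. norm (DF F z v) \<le> K * norm v"
    using DF_bounded[OF R(1) lift diff cont] ..
  then have K: "norm (DF F z v) \<le> K * norm v" if "z \<in> Dl R" for z v using that by blast
  have inv: "F z \<in> Wcs R F" if "z \<in> Wcs R F" for z
  proof -
    have "(F ^^ n) (F z) \<in> Dl R" for n
      using that[unfolded Wcs_def, THEN CollectD, THEN spec, of "Suc n"] by (simp add: funpow_swap1)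
    then show ?thesis unfolding Wcs_def by (intro CollectI allI)
  qed
  have W: "Wcs R F \<subseteq> Dl R"
  proof
    fix z assume "z \<in> Wcs R F"
    from this[unfolded Wcs_def, THEN CollectD, THEN spec, of 0] show "z \<in> Dl R" by simp
  qed
  have "0 < L" using M by simp
  have rateL: "1 < xi_u1P R F L" "mu_cs1 R F L < xi_u1P R F L"
    using rate unfolding rate_conditions_def by auto
  have "0 \<le> mu_cs1 R F M" using mu_cs1_nonneg[OF R(1) diff K] M(1) by simp
  \<comment> \<open>Since \<open>x / 0 = 0\<close>, a vanishing \<mu> would contradict
    \<open>ratio\<close>; hence \<mu> is positive and can be multiplied out.\<close>
  with ratio have rateM: "mu_cs1 R F M < xi_u1P R F M"
    by (cases "mu_cs1 R F M = 0") (auto simp: less_divide_eq)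
  have z: "(l1, w l1 y1, y1) \<in> Wcs R F" "(l2, w l2 y2, y2) \<in> Wcs R F"
    using y unfolding graph by blast+
  \<comment> \<open>The constant \<open>L\<close> from the cone argument is the upper endpoint
    \<open>N\<close> of the descent.\<close>
  note lipL = invariant_set_lipschitz[OF R(1) diff K inv W \<open>0 < L\<close> rateL(1) less_imp_le[OF rateL(2)]]
  from invariant_set_lipschitz_descent[OF R(1) diff K inv W M(1) less_imp_le[OF M(2)] lipL rateM rateL(2) z]
  show "norm (w l1 y1 - w l2 y2) \<le> M * norm (l1 - l2, y1 - y2)"
    by (simp add: px_def ply_def)
qed

end
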